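(* Let $T$ be a tree with vertex set $\{1,\ldots,n\}$, edge set $\{e_1,\ldots,e_{n-1}\}$ and nonzero real edge weights $w_1,\ldots,w_{n-1}$. Suppose $T$ has no vertex of degree $2$. Then the squared distance matrix $\Delta$ of $T$ satisfies $$\det\Delta=(-1)^{n-1}\frac{4^{n-2}}{2}\prod_{i=1}^n\tau_i\prod_{i=1}^{n-1}w_i^2\sum_{i=1}^n\frac{\hat\delta_i^2}{\tau_i}.$$
   Context: For vertices $i\neq j$, $d(i,j)$ is the sum of the weights of the edges on the unique $ij$-path, $d(i,i)=0$, and $\Delta$ is the $n\times n$ matrix with $(i,j)$-entry $d(i,j)^2$. $\tau_i=2-\delta_i$ where $\delta_i$ is the degree of vertex $i$ (nonzero here since no vertex has degree $2$), and $\hat\delta_i$ is the sum of the weights of the edges incident to vertex $i$. *)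

theory Defs
  imports Complex_Main "Jordan_Normal_Form.Determinant"
begin

text \<open>
  Simple undirected graphs are given by a finite vertex set \<open>V\<close> and a set \<open>E\<close> of two-element
  subsets of \<open>V\<close>. (The trees of the Graph\_Theory entry are directed: their forests exclude
  directed cycles only, so orientations of undirected cycles are not ruled out.)
\<close>

definition simple_graph :: "'a set \<Rightarrow> 'a set set \<Rightarrow> bool" where
  "simple_graph V E \<longleftrightarrow> finite V \<and> (\<forall>x\<in>E. \<exists>u\<in>V. \<exists>v\<in>V. u \<noteq> v \<and> x = {u, v})"

fun path_edges :: "'a list \<Rightarrow> 'a set set" where
  "path_edges (u # v # p) = insert {u, v} (path_edges (v # p))"
| "path_edges _ = {}"

definition path_between :: "'a set \<Rightarrow> 'a set set \<Rightarrow> 'a \<Rightarrow> 'a \<Rightarrow> 'a list \<Rightarrow> bool" where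
  "path_between V E u v p \<longleftrightarrow>
     p \<noteq> [] \<and> distinct p \<and> set p \<subseteq> V \<and> path_edges p \<subseteq> E \<and> hd p = u \<and> last p = v"

definition graph_cycle :: "'a set \<Rightarrow> 'a set set \<Rightarrow> 'a list \<Rightarrow> bool" where
  "graph_cycle V E p \<longleftrightarrow>
     length p \<ge> 3 \<and> distinct p \<and> set p \<subseteq> V \<and> path_edges p \<subseteq> E \<and> {last p, hd p} \<in> E"

definition is_tree :: "'a set \<Rightarrow> 'a set set \<Rightarrow> bool" where
  "is_tree V E \<longleftrightarrow> simple_graph V E \<and> V \<noteq> {} \<and>
     (\<forall>u\<in>V. \<forall>v\<in>V. \<exists>p. path_between V E u v p) \<and> (\<nexists>p. graph_cycle V E p)"

text \<open>
  From here on the vertices are \<open>1, \<dots>, n\<close>, and \<open>e k\<close> and \<open>w k\<close> are the \<open>k\<close>-th edge and its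
  weight, for \<open>k = 1, \<dots>, n - 1\<close>. The map \<open>e\<close> is meant to be injective on these indices.
\<close>

definition edge_set :: "nat \<Rightarrow> (nat \<Rightarrow> nat set) \<Rightarrow> nat set set" where
  "edge_set n e = e ` {1..n - 1}"

text \<open>
  The description below denotes a path only when exactly one exists, as it does in a tree. For
  \<open>i = j\<close> this path is \<open>[i]\<close>, which has no edges.
\<close>

definition tree_path :: "nat \<Rightarrow> (nat \<Rightarrow> nat set) \<Rightarrow> nat \<Rightarrow> nat \<Rightarrow> nat list" where
  "tree_path n e i j = (THE p. path_between {1..n} (edge_set n e) i j p)"

definition tree_dist :: "nat \<Rightarrow> (nat \<Rightarrow> nat set) \<Rightarrow> (nat \<Rightarrow> real) \<Rightarrow> nat \<Rightarrow> nat \<Rightarrow> real" where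
  "tree_dist n e w i j =
     (if i = j then 0
      else (\<Sum>k \<in> {k \<in> {1..n - 1}. e k \<in> path_edges (tree_path n e i j)}. w k))"

text \<open>Matrix indices start at 0, hence the shift by one.\<close>

definition sq_dist_mat :: "nat \<Rightarrow> (nat \<Rightarrow> nat set) \<Rightarrow> (nat \<Rightarrow> real) \<Rightarrow> real mat" where
  "sq_dist_mat n e w = mat n n (\<lambda>(i, j). (tree_dist n e w (i + 1) (j + 1))\<^sup>2)"

definition vertex_deg :: "nat \<Rightarrow> (nat \<Rightarrow> nat set) \<Rightarrow> nat \<Rightarrow> nat" where
  "vertex_deg n e i = card {x \<in> edge_set n e. i \<in> x}"

definition weighted_deg :: "nat \<Rightarrow> (nat \<Rightarrow> nat set) \<Rightarrow> (nat \<Rightarrow> real) \<Rightarrow> nat \<Rightarrow> real" where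
  "weighted_deg n e w i = (\<Sum>k \<in> {k \<in> {1..n - 1}. i \<in> e k}. w k)"

definition tau :: "nat \<Rightarrow> (nat \<Rightarrow> nat set) \<Rightarrow> nat \<Rightarrow> real" where
  "tau n e i = 2 - real (vertex_deg n e i)"

end

theory Submission
  imports Defs
begin

text \<open>
  Let \<open>L\<close> be the Laplacian with edge weights \<open>1 / w\<close>, \<open>D\<close> the distance matrix, \<open>Q\<close> the
  vertex-edge incidence matrix, and \<open>\<tau>\<close>, \<open>\<delta>\<close> the vectors of the numbers \<open>\<tau>\<^sub>i\<close> and of the weighted
  degrees. Orienting every edge away from a fixed vertex \<open>i\<close>, each vertex other than \<open>i\<close> is the far
  end of exactly one edge, which gives \<open>D L = 1 \<tau>\<^sup>T - 2 I\<close> and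
  \<open>\<Delta> L = 2 D diag(\<tau>) - 1 \<delta>\<^sup>T\<close>. Put \<open>u = \<tau> - L diag(\<tau>)\<^sup>-\<^sup>1 \<delta> / 2\<close>; then
  \<open>\<Delta> u\<close> is half of \<open>c = \<Sum> \<delta>\<^sub>i\<^sup>2 / \<tau>\<^sub>i\<close> times \<open>1\<close>, and
  \<open>\<Delta> (L + u \<tau>\<^sup>T) diag(\<tau>)\<^sup>-\<^sup>1 (L + \<tau> \<tau>\<^sup>T)\<close> is \<open>- 4 I\<close> plus a matrix with equal rows. Here
  \<open>L + x \<tau>\<^sup>T = [Q | x] [Q W\<^sup>-\<^sup>1 | \<tau>]\<^sup>T\<close> with \<open>W = diag(w)\<close>, and up to one common sign
  \<open>det [Q | x]\<close> is the sum of the entries of \<open>x\<close>.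
\<close>

section \<open>Paths in trees\<close>

lemma path_edges_append:
  "path_edges (p @ x # q) = path_edges (p @ [x]) \<union> path_edges (x # q)"
  by (induction p rule: path_edges.induct) (cases q; auto)+

lemma path_edges_snoc: "p \<noteq> [] \<Longrightarrow> path_edges (p @ [x]) = insert {last p, x} (path_edges p)"
  by (induction p rule: path_edges.induct) auto

lemma path_edges_rev: "path_edges (rev p) = path_edges p"
  by (induction p rule: path_edges.induct)
    (auto simp: path_edges_append[of _ _ "[_]"] insert_commute)

lemma path_edges_subset: "x \<in> path_edges p \<Longrightarrow> x \<subseteq> set p"
  by (induction p rule: path_edges.induct) auto

text \<open>If two paths part at their first step, the stretches up to where they first meet again
  close a cycle; if they agree there, induction applies to the tails.\<close>

lemma path_unique:
  assumes acyclic: "\<nexists>p. graph_cycle V E p"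
  shows "\<lbrakk>path_between V E u v p; path_between V E u v q\<rbrakk> \<Longrightarrow> p = q"
proof (induction p arbitrary: u q)
  case Nil
  then show ?case by (simp add: path_between_def)
next
  case (Cons a p')
  have au: "a = u" using Cons.prems by (simp add: path_between_def)
  obtain q' where q: "q = u # q'"
    using Cons.prems(2) by (cases q) (auto simp: path_between_def)
  show ?case
  proof (cases "u = v")
    case True
    then show ?thesis
      using Cons.prems q au by (auto simp: path_between_def split: if_splits dest: last_in_set)
  next
    case False
    then have ne: "p' \<noteq> []" "q' \<noteq> []"
      using Cons.prems q au by (auto simp: path_between_def)
    have v_last: "last p' = v" "last q' = v"
      using Cons.prems q au ne by (auto simp: path_between_def)
    have p'_edges: "path_edges p' \<subseteq> E" "{u, hd p'} \<in> E" and q'_edges: "path_edges q' \<subseteq> E" "{u, hd q'} \<in> E"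
      using Cons.prems q au ne
      by (cases p'; cases q'; auto simp: path_between_def)+
    show ?thesis
    proof (cases "hd p' = hd q'")
      case True
      have "path_between V E (hd p') v p'" "path_between V E (hd p') v q'"
        using Cons.prems q au ne v_last p'_edges q'_edges True by (auto simp: path_between_def)
      then show ?thesis using Cons.IH q au by blast
    next
      case hd_neq: False
      have "\<exists>x\<in>set p'. x \<in> set q'"
        using ne v_last last_in_set by metis
      \<comment> \<open>Taking \<open>x\<close> as the first vertex of \<open>p'\<close> on
        \<open>q'\<close> keeps \<open>p1\<close> disjoint from \<open>q'\<close>, so the closed
        walk \<open>?c\<close> repeats no vertex. As the first steps differ, \<open>p1\<close> or
        \<open>q1\<close> is nonempty, which gives the length 3.\<close>
      then obtain p1 x p2 where p': "p' = p1 @ x # p2" and x: "x \<in> set q'"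
        and p1: "\<forall>y\<in>set p1. y \<notin> set q'"
        using split_list_first_prop[of p' "\<lambda>x. x \<in> set q'"] by blast
      obtain q1 q2 where q': "q' = q1 @ x # q2"
        using split_list[OF x] by blast
      let ?c = "u # p1 @ x # rev q1"
      have "p1 \<noteq> [] \<or> q1 \<noteq> []" using hd_neq p' q' by auto
      then have len: "length ?c \<ge> 3" by (cases p1; cases q1) auto
      have dist: "distinct ?c" "set ?c \<subseteq> V"
        using Cons.prems q au p' q' p1 by (auto simp: path_between_def)
      have "path_edges (u # p1 @ [x]) \<subseteq> E"
        using p'_edges p' path_edges_append[of p1 x p2]
        by (cases p1) (auto simp: path_edges_append[of _ x p2])
      moreover have "path_edges (x # rev q1) \<subseteq> E"
        using q'_edges q' path_edges_append[of q1 x q2] path_edges_rev[of "q1 @ [x]"] by auto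
      ultimately have "path_edges ?c \<subseteq> E"
        using path_edges_append[of "u # p1" x "rev q1"] by auto
      moreover have "last ?c = hd q'"
        using q' by (cases q1) auto
      ultimately have "graph_cycle V E ?c"
        using len dist q'_edges(2) by (auto simp: graph_cycle_def insert_commute)
      then show ?thesis using acyclic by blast
    qed
  qed
qed

lemma path_extend:
  assumes "path_between V E i u p" "{u, v} \<in> E" "v \<in> V" "v \<notin> set p"
  shows "path_between V E i v (p @ [v])"
  using assms by (auto simp: path_between_def path_edges_snoc)

text \<open>By uniqueness, a path to \<open>u\<close> avoiding \<open>v\<close> extends to the path
  to \<open>v\<close>; if it meets \<open>v\<close>, its tail from \<open>v\<close> must be the
  single edge to \<open>u\<close>.\<close>

lemma path_ends:
  assumes "is_tree V E" "i \<in> V" "{u, v} \<in> E" "u \<in> V" "v \<in> V" "u \<noteq> v"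
    and p: "path_between V E i u p" and q: "path_between V E i v q"
  shows "q = p @ [v] \<and> v \<notin> set p \<or> p = q @ [u] \<and> u \<notin> set q"
proof -
  have acyclic: "\<nexists>p. graph_cycle V E p" using assms(1) by (simp add: is_tree_def)
  show ?thesis
  proof (cases "v \<in> set p")
    case False
    then show ?thesis
      using path_unique[OF acyclic q path_extend[OF p]] assms by blast
  next
    case True
    then obtain p1 p2 where ps: "p = p1 @ v # p2" using split_list by metis
    have "path_between V E v u (v # p2)"
      using p ps path_edges_append[of p1 v p2] by (auto simp: path_between_def)
    moreover have "path_between V E v u [v, u]"
      using assms by (auto simp: path_between_def insert_commute)
    ultimately have "v # p2 = [v, u]" by (rule path_unique[OF acyclic])
    then have ps': "p = (p1 @ [v]) @ [u]" using ps by simp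
    have "path_between V E i v (p1 @ [v])"
      using p ps path_edges_append[of p1 v p2] by (cases p1) (auto simp: path_between_def)
    then have "q = p1 @ [v]" using path_unique[OF acyclic q] by blast
    then show ?thesis using ps' p by (auto simp: path_between_def)
  qed
qed

section \<open>Edges oriented away from a vertex\<close>

text \<open>Seen from \<open>i\<close>, the end \<open>u\<close> of edge \<open>k\<close> is the far
  one and \<open>v\<close> the near one.\<close>

definition edge_away :: "nat \<Rightarrow> (nat \<Rightarrow> nat set) \<Rightarrow> nat \<Rightarrow> nat \<Rightarrow> nat \<Rightarrow> nat \<Rightarrow> bool" where
  "edge_away n e i k u v \<longleftrightarrow> e k = {u, v} \<and> tree_path n e i u = tree_path n e i v @ [u]
    \<and> u \<notin> set (tree_path n e i v)"

context
  fixes n :: nat and e :: "nat \<Rightarrow> nat set"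
  assumes tree: "is_tree {1..n} (edge_set n e)"
    and inj: "inj_on e {1..n - 1}"
begin

lemma no_graph_cycle: "\<nexists>p. graph_cycle {1..n} (edge_set n e) p"
  using tree by (simp add: is_tree_def)

lemma tree_path_eqI:
  "path_between {1..n} (edge_set n e) i j p \<Longrightarrow> tree_path n e i j = p"
  unfolding tree_path_def using path_unique[OF no_graph_cycle] by blast

lemma path_between_tree_path:
  assumes "i \<in> {1..n}" "j \<in> {1..n}"
  shows "path_between {1..n} (edge_set n e) i j (tree_path n e i j)"
proof -
  obtain p where "path_between {1..n} (edge_set n e) i j p"
    using tree assms unfolding is_tree_def by blast
  then show ?thesis using tree_path_eqI by blast
qed

lemma tree_path_self: "i \<in> {1..n} \<Longrightarrow> tree_path n e i i = [i]"
  by (rule tree_path_eqI) (simp add: path_between_def)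

lemma last_tree_path:
  assumes "i \<in> {1..n}" "j \<in> {1..n}"
  shows "tree_path n e i j \<noteq> []" "last (tree_path n e i j) = j"
  using path_between_tree_path[OF assms] by (simp_all add: path_between_def)

lemma edge_away_exists:
  assumes "i \<in> {1..n}" "k \<in> {1..n - 1}"
  shows "\<exists>u\<in>{1..n}. \<exists>v\<in>{1..n}. edge_away n e i k u v"
proof -
  have "e k \<in> edge_set n e" using assms by (simp add: edge_set_def)
  then obtain u v where uv: "u \<in> {1..n}" "v \<in> {1..n}" "u \<noteq> v" "e k = {u, v}"
    using tree unfolding is_tree_def simple_graph_def by metis
  have "edge_away n e i k u v \<or> edge_away n e i k v u"
    using path_ends[OF tree assms(1) _ uv(1-3) path_between_tree_path[OF assms(1) uv(1)]
        path_between_tree_path[OF assms(1) uv(2)]]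
      \<open>e k \<in> edge_set n e\<close>
    unfolding edge_away_def uv(4) insert_commute[of v u] by blast
  then show ?thesis using uv by blast
qed

text \<open>The witness is the last edge on the path from \<open>i\<close> to \<open>j\<close>. The
  universal form lets the lemma apply to ends that were chosen beforehand.\<close>

lemma edge_away_surj:
  assumes "i \<in> {1..n}" "j \<in> {1..n}" "i \<noteq> j"
  shows "\<exists>k\<in>{1..n - 1}. \<forall>u\<in>{1..n}. \<forall>v\<in>{1..n}. edge_away n e i k u v \<longrightarrow> u = j"
proof -
  define p where "p = butlast (tree_path n e i j)"
  have path: "path_between {1..n} (edge_set n e) i j (tree_path n e i j)"
    using path_between_tree_path assms by blast
  have pj: "tree_path n e i j = p @ [j]"
    using last_tree_path[OF assms(1,2)] unfolding p_def by (metis append_butlast_last_id)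
  have "p \<noteq> []" using path pj assms(3) by (auto simp: path_between_def)
  then have "path_between {1..n} (edge_set n e) i (last p) p" and "{last p, j} \<in> edge_set n e"
    using path pj by (auto simp: path_between_def path_edges_snoc)
  then have p: "tree_path n e i (last p) = p" and "{last p, j} \<in> e ` {1..n - 1}"
    using tree_path_eqI by (simp_all add: edge_set_def)
  then obtain k where k: "k \<in> {1..n - 1}" "e k = {last p, j}" by (metis imageE)
  have "u = j" if "edge_away n e i k u v" for u v
  \<comment> \<open>The opposite orientation would make the path to \<open>last p\<close> an
    extension of itself by two vertices.\<close>
  proof (rule ccontr)
    assume "u \<noteq> j"
    then have "u = last p" "v = j"
      using that k by (auto simp: edge_away_def doubleton_eq_iff)
    then have "p = (p @ [j]) @ [last p]" using that p pj by (simp add: edge_away_def)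
    then have "length p = length ((p @ [j]) @ [last p])" by (rule arg_cong)
    then show False by simp
  qed
  then show ?thesis using k by blast
qed

text \<open>The path to the far end is the path to the near end followed by edge \<open>k\<close>;
  injectivity of \<open>e\<close> turns equal edges into equal indices. Edge \<open>k\<close> is new
  because the earlier path avoids \<open>u\<close>.\<close>

lemma edge_away_path_edges:
  assumes "i \<in> {1..n}" "k \<in> {1..n - 1}" "v \<in> {1..n}" "edge_away n e i k u v"
    and l: "l \<in> {1..n - 1}"
  shows "e l \<in> path_edges (tree_path n e i u)
    \<longleftrightarrow> l = k \<or> e l \<in> path_edges (tree_path n e i v)"
    and "e k \<notin> path_edges (tree_path n e i v)"
proof -
  have "path_edges (tree_path n e i u) = insert (e k) (path_edges (tree_path n e i v))"
    using assms last_tree_path[OF assms(1,3)]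
    by (simp add: edge_away_def path_edges_snoc insert_commute)
  then show "e l \<in> path_edges (tree_path n e i u)
      \<longleftrightarrow> l = k \<or> e l \<in> path_edges (tree_path n e i v)"
    using inj_on_eq_iff[OF inj l assms(2)] by auto
  show "e k \<notin> path_edges (tree_path n e i v)"
    using path_edges_subset[of "e k" "tree_path n e i v"] assms(4) by (auto simp: edge_away_def)
qed

lemma tree_dist_eq_sum:
  assumes "i \<in> {1..n}"
  shows "tree_dist n e w i j = (\<Sum>k | k \<in> {1..n - 1} \<and> e k \<in> path_edges (tree_path n e i j). w k)"
  using tree_path_self[OF assms] by (auto simp: tree_dist_def)

lemma tree_dist_edge_away:
  assumes "i \<in> {1..n}" "k \<in> {1..n - 1}" "v \<in> {1..n}" "edge_away n e i k u v"
  shows "tree_dist n e w i u = tree_dist n e w i v + w k"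
proof -
  let ?S = "\<lambda>j. {k \<in> {1..n - 1}. e k \<in> path_edges (tree_path n e i j)}"
  have S: "?S u = insert k (?S v)" and k: "k \<notin> ?S v"
    using edge_away_path_edges[OF assms] assms(2) by blast+
  have "finite (?S v)" by simp
  then have "sum w (?S u) = w k + sum w (?S v)"
    unfolding S by (rule sum.insert[OF _ k])
  then show ?thesis
    unfolding tree_dist_eq_sum[OF assms(1)] by linarith
qed

lemma vertex_deg_eq_card: "vertex_deg n e i = card {k \<in> {1..n - 1}. i \<in> e k}"
proof -
  have "{x \<in> edge_set n e. i \<in> x} = e ` {k \<in> {1..n - 1}. i \<in> e k}"
    by (auto simp: edge_set_def)
  moreover have "inj_on e {k \<in> {1..n - 1}. i \<in> e k}"
    using inj by (rule inj_on_subset) auto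
  ultimately show ?thesis by (simp add: vertex_deg_def card_image)
qed

end

section \<open>The determinant identity\<close>

text \<open>The value \<open>r f j\<close> indicates whether edge \<open>f\<close> separates \<open>j\<close> from vertex \<open>0\<close>; it is kept
  in \<open>int\<close> so that the matrix inverse to a bordered incidence matrix is seen to be integral.\<close>

locale weighted_tree =
  fixes m :: nat and w :: "nat \<Rightarrow> real" and d :: "nat \<Rightarrow> nat \<Rightarrow> real"
    and far near :: "nat \<Rightarrow> nat \<Rightarrow> nat" and r :: "nat \<Rightarrow> nat \<Rightarrow> int"
  assumes w_nonzero: "k < m \<Longrightarrow> w k \<noteq> 0"
    and near_le: "i \<le> m \<Longrightarrow> k < m \<Longrightarrow> near i k \<le> m"
    and far_neq_near: "i \<le> m \<Longrightarrow> k < m \<Longrightarrow> far i k \<noteq> near i k"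
    and ends_eq: "i \<le> m \<Longrightarrow> k < m \<Longrightarrow> {far i k, near i k} = {far 0 k, near 0 k}"
    and dist_self: "i \<le> m \<Longrightarrow> d i i = 0"
    and dist_far: "i \<le> m \<Longrightarrow> k < m \<Longrightarrow> d i (far i k) = d i (near i k) + w k"
    and far_bij: "i \<le> m \<Longrightarrow> bij_betw (far i) {..<m} ({..m} - {i})"
    and side_root: "f < m \<Longrightarrow> r f 0 = 0"
    and side_far: "f < m \<Longrightarrow> k < m \<Longrightarrow> r f (far 0 k) = r f (near 0 k) + of_bool (f = k)"
begin

section \<open>Incidence matrix, Laplacian and degrees\<close>

lemma far_le: "i \<le> m \<Longrightarrow> k < m \<Longrightarrow> far i k \<le> m"
  using far_bij[of i] by (auto simp: bij_betw_def)

text \<open>The incidence matrix \<open>Q\<close>, with edges oriented away from vertex 0. It is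
  generic in the ring because it is needed over both the integers and the reals.\<close>

definition inc :: "nat \<Rightarrow> nat \<Rightarrow> 'a::comm_ring_1" where
  "inc j k = of_bool (j = far 0 k) - of_bool (j = near 0 k)"

text \<open>The Laplacian in its factored form \<open>Q W^-1 Q^T\<close>.\<close>

definition lap :: "nat \<Rightarrow> nat \<Rightarrow> real" where
  "lap j l = (\<Sum>k<m. inc j k * inc l k / w k)"

definition wdeg :: "nat \<Rightarrow> real" where
  "wdeg j = (\<Sum>k<m. of_bool (j \<in> {far 0 k, near 0 k}) * w k)"

definition tau :: "nat \<Rightarrow> real" where
  "tau j = 2 - (\<Sum>k<m. of_bool (j \<in> {far 0 k, near 0 k}))"

lemma sum_of_bool_eq:
  fixes x :: "nat \<Rightarrow> 'a::comm_ring_1"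
  assumes "p \<le> m"
  shows "(\<Sum>j\<le>m. x j * of_bool (j = p)) = x p"
proof -
  have "(\<Sum>j\<le>m. x j * of_bool (j = p)) = (\<Sum>j\<le>m. if j = p then x j else 0)"
    by (intro sum.cong) auto
  then show ?thesis using assms by simp
qed

lemma sum_inc:
  fixes x :: "nat \<Rightarrow> 'a::comm_ring_1"
  assumes "k < m"
  shows "(\<Sum>j\<le>m. x j * inc j k) = x (far 0 k) - x (near 0 k)"
  using sum_of_bool_eq[of "far 0 k" x] sum_of_bool_eq[of "near 0 k" x]
    far_le[of 0 k] near_le[of 0 k] assms
  by (simp add: inc_def right_diff_distrib sum_subtractf)

lemma lap_sym: "lap j l = lap l j"
  by (simp add: lap_def mult.commute)

lemma sum_lap: "(\<Sum>l\<le>m. x l * lap l j) = (\<Sum>k<m. (x (far 0 k) - x (near 0 k)) * inc j k / w k)"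
proof -
  have "(\<Sum>l\<le>m. x l * lap l j) = (\<Sum>l\<le>m. \<Sum>k<m. x l * inc l k * (inc j k / w k))"
    by (simp add: lap_def sum_distrib_left mult.assoc)
  also have "\<dots> = (\<Sum>k<m. (\<Sum>l\<le>m. x l * inc l k) * (inc j k / w k))"
    by (subst sum.swap) (simp only: sum_distrib_right)
  also have "\<dots> = (\<Sum>k<m. (x (far 0 k) - x (near 0 k)) * inc j k / w k)"
    by (intro sum.cong) (simp_all add: sum_inc)
  finally show ?thesis .
qed

lemma sum_lap_const: "(\<Sum>l\<le>m. lap l j) = 0"
  using sum_lap[of "\<lambda>_. 1"] by simp

text \<open>The quadratic expression in the incidence vector of an edge does not depend on the
  orientation, so each edge may be oriented away from \<open>i\<close>.\<close>

lemma reorient: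
  assumes "i \<le> m" "k < m"
  shows "(x (far 0 k) - x (near 0 k)) * inc j k
    = (x (far i k) - x (near i k)) * (of_bool (j = far i k) - of_bool (j = near i k) :: real)"
proof -
  have "far i k = far 0 k \<and> near i k = near 0 k \<or> far i k = near 0 k \<and> near i k = far 0 k"
    using ends_eq[OF assms] by (auto simp: doubleton_eq_iff)
  then show ?thesis by (auto simp: inc_def algebra_simps)
qed

lemma member_ends:
  assumes "i \<le> m" "k < m"
  shows "of_bool (j \<in> {far 0 k, near 0 k})
    = (of_bool (j = far i k) + of_bool (j = near i k) :: real)"
  using far_neq_near[OF assms] by (auto simp flip: ends_eq[OF assms])

lemma sum_far:
  fixes g :: "nat \<Rightarrow> real"
  assumes "i \<le> m"
  shows "(\<Sum>k<m. g (far i k)) = (\<Sum>j\<in>{..m} - {i}. g j)"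
  by (rule sum.reindex_bij_betw[OF far_bij[OF assms]])

lemma sum_far_eq:
  assumes "i \<le> m" "j \<le> m"
  shows "(\<Sum>k<m. of_bool (j = far i k)) = (of_bool (j \<noteq> i) :: real)"
proof -
  have "(\<Sum>k<m. of_bool (j = far i k)) = (\<Sum>l\<in>{..m} - {i}. of_bool (j = l) :: real)"
    by (rule sum_far[OF assms(1)])
  also have "\<dots> = (\<Sum>l\<in>{..m} - {i}. if j = l then 1 else 0)"
    by (intro sum.cong) auto
  also have "\<dots> = of_bool (j \<noteq> i)"
    using assms by (subst sum.delta') auto
  finally show ?thesis .
qed

section \<open>Distances against the Laplacian and the degree vectors\<close>

text \<open>A vertex other than \<open>i\<close> is the far end of one of its edges and the near end
  of the rest, so its signs add to 1 - (deg - 1); at \<open>i\<close> all signs are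
  negative.\<close>

lemma sum_sign:
  assumes "i \<le> m" "j \<le> m"
  shows "(\<Sum>k<m. of_bool (j = far i k) - of_bool (j = near i k)) = tau j - 2 * of_bool (i = j)"
proof -
  have "(\<Sum>k<m. of_bool (j = far i k) - of_bool (j = near i k))
      = (\<Sum>k<m. 2 * of_bool (j = far i k) - of_bool (j \<in> {far 0 k, near 0 k}) :: real)"
    by (intro sum.cong) (use member_ends[OF assms(1)] in \<open>auto simp del: insert_iff\<close>)
  also have "\<dots> = 2 * of_bool (j \<noteq> i) - (2 - tau j)"
    by (simp add: sum_subtractf sum_far_eq[OF assms] tau_def flip: sum_distrib_left)
  finally show ?thesis by auto
qed

text \<open>Distances from \<open>i\<close> grow by \<open>w k\<close> across edge \<open>k\<close>,
  which cancels the Laplacian weight and leaves only the signs.\<close>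

lemma dist_lap:
  assumes "i \<le> m" "j \<le> m"
  shows "(\<Sum>l\<le>m. d i l * lap l j) = tau j - 2 * of_bool (i = j)"
proof -
  have "(\<Sum>l\<le>m. d i l * lap l j)
      = (\<Sum>k<m. of_bool (j = far i k) - of_bool (j = near i k))"
    unfolding sum_lap
    by (intro sum.cong) (auto simp: reorient[OF assms(1)] dist_far[OF assms(1)] w_nonzero)
  then show ?thesis using sum_sign[OF assms] by simp
qed

text \<open>With near distance \<open>a\<close>, an edge contributes ((a + w)^2 - a^2) / w = 2 a +
  w, which is 2 (a + w) - w at the far end; with the signs, both ends yield plus or minus 2
  \<open>d i j\<close>, minus \<open>w\<close>. The diagonal correction vanishes since
  \<open>d i i = 0\<close>.\<close>

lemma sq_dist_lap:
  assumes "i \<le> m" "j \<le> m"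
  shows "(\<Sum>l\<le>m. (d i l)\<^sup>2 * lap l j) = 2 * d i j * tau j - wdeg j"
proof -
  have "((d i (far 0 k))\<^sup>2 - (d i (near 0 k))\<^sup>2) * inc j k / w k
      = 2 * d i j * (of_bool (j = far i k) - of_bool (j = near i k))
        - of_bool (j \<in> {far 0 k, near 0 k}) * w k" if "k < m" for k
    unfolding reorient[OF assms(1) that, of "\<lambda>l. (d i l)\<^sup>2"] member_ends[OF assms(1) that]
    using dist_far[OF assms(1) that] far_neq_near[OF assms(1) that] w_nonzero[OF that]
    by (auto simp: field_simps power2_eq_square)
  then have "(\<Sum>l\<le>m. (d i l)\<^sup>2 * lap l j)
      = (\<Sum>k<m. 2 * d i j * (of_bool (j = far i k) - of_bool (j = near i k))
        - of_bool (j \<in> {far 0 k, near 0 k}) * w k)"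
    unfolding sum_lap by (intro sum.cong) auto
  also have "\<dots> = 2 * d i j * (tau j - 2 * of_bool (i = j)) - wdeg j"
    unfolding sum_sign[OF assms, symmetric] wdeg_def
    by (simp only: sum_subtractf sum_distrib_left right_diff_distrib)
  finally show ?thesis using dist_self[OF assms(1)] by auto
qed

lemma sum_member_ends:
  assumes "k < m"
  shows "(\<Sum>j\<le>m. x j * of_bool (j \<in> {far 0 k, near 0 k})) = (x (far 0 k) + x (near 0 k) :: real)"
  unfolding member_ends[OF le0 assms]
  using sum_of_bool_eq[of "far 0 k" x] sum_of_bool_eq[of "near 0 k" x]
    far_le[of 0 k] near_le[of 0 k] assms
  by (simp add: ring_distribs sum.distrib)

text \<open>The handshake count: \<open>m\<close> edges contribute 2 each to the degrees of
  \<open>m + 1\<close> vertices.\<close>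

lemma sum_tau: "(\<Sum>j\<le>m. tau j) = 2"
proof -
  have "(\<Sum>j\<le>m. tau j) = 2 * (real m + 1)
      - (\<Sum>k<m. \<Sum>j\<le>m. 1 * of_bool (j \<in> {far 0 k, near 0 k}))"
    by (subst sum.swap) (simp add: tau_def sum_subtractf)
  also have "(\<Sum>k<m. \<Sum>j\<le>m. 1 * of_bool (j \<in> {far 0 k, near 0 k})) = (\<Sum>k<m. 2 :: real)"
    by (intro sum.cong refl, subst sum_member_ends) auto
  finally show ?thesis by simp
qed

lemma sum_wdeg: "(\<Sum>j\<le>m. x j * wdeg j) = (\<Sum>k<m. (x (far 0 k) + x (near 0 k)) * w k)"
proof -
  have "(\<Sum>j\<le>m. x j * wdeg j)
      = (\<Sum>j\<le>m. \<Sum>k<m. x j * of_bool (j \<in> {far 0 k, near 0 k}) * w k)"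
    by (simp only: wdeg_def sum_distrib_left mult.assoc)
  also have "\<dots> = (\<Sum>k<m. (\<Sum>j\<le>m. x j * of_bool (j \<in> {far 0 k, near 0 k})) * w k)"
    by (subst sum.swap) (simp only: sum_distrib_right)
  also have "\<dots> = (\<Sum>k<m. (x (far 0 k) + x (near 0 k)) * w k)"
    by (intro sum.cong refl, subst sum_member_ends) auto
  finally show ?thesis .
qed


text \<open>This is \<open>sum_sign\<close> summed against \<open>x\<close>; the condition
  \<open>x i = 0\<close> removes its diagonal term.\<close>

lemma sum_mult_tau:
  assumes "i \<le> m" "x i = 0"
  shows "(\<Sum>j\<le>m. x j * tau j) = (\<Sum>k<m. x (far i k) - x (near i k))"
proof -
  have "(\<Sum>j\<le>m. x j * tau j)
      = (\<Sum>j\<le>m. x j * (\<Sum>k<m. of_bool (j = far i k) - of_bool (j = near i k)))"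
    by (intro sum.cong refl, subst sum_sign) (use assms in auto)
  also have "\<dots> = (\<Sum>k<m. \<Sum>j\<le>m. x j * (of_bool (j = far i k) - of_bool (j = near i k)))"
    by (subst sum.swap) (simp add: sum_distrib_left)
  also have "\<dots> = (\<Sum>k<m. x (far i k) - x (near i k))"
    using assms far_le near_le
    by (intro sum.cong refl)
      (simp add: right_diff_distrib sum_subtractf sum_of_bool_eq del: sum_mult_of_bool_eq)
  finally show ?thesis .
qed

lemma sum_dist_tau:
  assumes "i \<le> m"
  shows "(\<Sum>j\<le>m. d i j * tau j) = (\<Sum>k<m. w k)"
  using assms by (simp add: sum_mult_tau dist_self dist_far)

text \<open>Across each edge the difference of squares factors as the sum of the two distances times
  the weight. In matrix form, \<open>\<Delta> \<tau> = D \<delta>\<close>.\<close>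

lemma sum_sq_dist_tau:
  assumes "i \<le> m"
  shows "(\<Sum>j\<le>m. (d i j)\<^sup>2 * tau j) = (\<Sum>j\<le>m. d i j * wdeg j)"
proof -
  have "d i (far 0 k) + d i (near 0 k) = d i (far i k) + d i (near i k)" if "k < m" for k
    using ends_eq[OF assms that] by (auto simp: doubleton_eq_iff)
  then have "(\<Sum>j\<le>m. d i j * wdeg j) = (\<Sum>k<m. (d i (far i k) + d i (near i k)) * w k)"
    by (simp add: sum_wdeg)
  also have "\<dots> = (\<Sum>k<m. (d i (far i k))\<^sup>2 - (d i (near i k))\<^sup>2)"
    by (intro sum.cong refl) (simp add: dist_far[OF assms] power2_eq_square algebra_simps)
  also have "\<dots> = (\<Sum>j\<le>m. (d i j)\<^sup>2 * tau j)"
    using assms by (simp add: sum_mult_tau dist_self)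
  finally show ?thesis by simp
qed

section \<open>Bordered incidence matrices\<close>

text \<open>The square matrix \<open>[Q diag(s) | x]\<close>; the scaling \<open>s\<close> is used
  with the values 1, \<open>1 / w\<close> and -4.\<close>

definition bord :: "(nat \<Rightarrow> 'a::comm_ring_1) \<Rightarrow> (nat \<Rightarrow> 'a) \<Rightarrow> 'a mat" where
  "bord s x = mat (Suc m) (Suc m) (\<lambda>(j, k). if k < m then s k * inc j k else x j)"

text \<open>The inverse of \<open>[Q | x]\<close> for \<open>x\<close> the indicator of vertex 0:
  its rows are the separation indicators of the edges, followed by a row of ones.\<close>

definition side_mat :: "'a::comm_ring_1 mat" where
  "side_mat = mat (Suc m) (Suc m) (\<lambda>(f, j). if f < m then of_int (r f j) else 1)"

lemma bord_carrier [simp]: "bord s x \<in> carrier_mat (Suc m) (Suc m)"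
  by (simp add: bord_def)

lemma side_mat_carrier [simp]: "side_mat \<in> carrier_mat (Suc m) (Suc m)"
  by (simp add: side_mat_def)

lemma index_mat_mult:
  assumes "A \<in> carrier_mat (Suc m) (Suc m)" "B \<in> carrier_mat (Suc m) (Suc m)" "i \<le> m" "j \<le> m"
  shows "(A * B) $$ (i, j) = (\<Sum>l\<le>m. A $$ (i, l) * B $$ (l, j))"
  using assms by (simp add: scalar_prod_def atLeast0LessThan lessThan_Suc_atMost)

text \<open>Edge \<open>f\<close> separates the ends of edge \<open>k\<close> only if
  \<open>f = k\<close>, and the row of ones annihilates incidence columns. So the product is upper
  triangular with diagonal \<open>s\<close>, followed by the sum of \<open>x\<close>.\<close>

lemma det_side_bord:
  fixes s x :: "nat \<Rightarrow> 'a::idom"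
  shows "det side_mat * det (bord s x) = (\<Prod>k<m. s k) * (\<Sum>j\<le>m. x j)"
proof -
  let ?P = "side_mat * bord s x"
  have ent: "?P $$ (f, k) = (if k < m then of_bool (f = k) * s k
      else if f < m then (\<Sum>j\<le>m. of_int (r f j) * x j) else (\<Sum>j\<le>m. x j))" if "f \<le> m" "k \<le> m" for f k
  proof -
    have entry: "?P $$ (f, k) = (\<Sum>j\<le>m. (if f < m then of_int (r f j) else 1) * (if k < m then s k * inc j k else x j))"
      using that by (subst index_mat_mult) (auto simp: side_mat_def bord_def)
    have sum_scaled: "(\<Sum>j\<le>m. y j * (s k * inc j k)) = s k * (y (far 0 k) - y (near 0 k))"
      if "k < m" for y :: "nat \<Rightarrow> 'a"
      using sum_inc[OF that, of y] by (simp add: mult_ac flip: sum_distrib_left)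
    show ?thesis
      using entry that sum_scaled[of "\<lambda>j. of_int (r f j)"] sum_scaled[of "\<lambda>_. 1"] side_far[of f k] by (cases "f < m"; cases "k < m") auto
  qed
  have P: "?P \<in> carrier_mat (Suc m) (Suc m)" by (rule mult_carrier_mat[of _ _ "Suc m"]) simp_all
  have "det ?P = prod_list (diag_mat ?P)"
    by (rule det_upper_triangular[OF _ P]) (use P in \<open>auto simp: upper_triangular_def ent\<close>)
  also have "\<dots> = (\<Prod>k<Suc m. ?P $$ (k, k))"
    by (simp add: prod_list_diag_prod atLeast0LessThan side_mat_def)
  also have "\<dots> = (\<Prod>k<m. s k) * (\<Sum>j\<le>m. x j)"
    by (simp add: ent)
  finally show ?thesis by (simp add: det_mult[of _ "Suc m"])
qed


text \<open>Over the integers this determinant divides 1, so it is 1 or -1. The square avoids the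
  sign, which depends on the numbering of vertices and edges.\<close>

lemma det_side_mat_sq: "(det (side_mat :: real mat))\<^sup>2 = 1"
proof -
  have "det (side_mat :: int mat) * det (bord (\<lambda>_. 1) (\<lambda>j. of_bool (j = 0))) = 1"
    by (subst det_side_bord) (use sum_of_bool_eq[of 0 "\<lambda>_. 1 :: int"] in simp)
  then have "(det (side_mat :: int mat))\<^sup>2 = 1"
    by (auto simp: zmult_eq_1_iff)
  moreover have "(side_mat :: real mat) = map_mat of_int side_mat"
    by (auto simp: side_mat_def)
  ultimately show ?thesis
    by (metis of_int_1 of_int_hom.hom_det of_int_power)
qed

section \<open>Determinant of the squared distance matrix\<close>

definition sq_mat :: "real mat" where
  "sq_mat = mat (Suc m) (Suc m) (\<lambda>(i, j). (d i j)\<^sup>2)"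

theorem det_sq_mat:
  assumes tau_nonzero: "\<And>j. j \<le> m \<Longrightarrow> tau j \<noteq> 0"
  shows "det sq_mat = (- 4) ^ m / 8 * (\<Prod>j\<le>m. tau j) * (\<Prod>k<m. (w k)\<^sup>2)
    * (\<Sum>j\<le>m. (wdeg j)\<^sup>2 / tau j)"
proof -
  define W where "W = (\<Sum>k<m. w k)"
  define y where "y j = wdeg j / tau j" for j
  define c where "c = (\<Sum>j\<le>m. (wdeg j)\<^sup>2 / tau j)"
  \<comment> \<open>This is \<open>L y\<close> with \<open>y = diag(\<tau>)^-1 \<delta>\<close>, so
    \<open>u\<close> below is the vector \<open>\<tau> - L y / 2\<close>.\<close>
  define yl where "yl j = (\<Sum>l\<le>m. y l * lap l j)" for j
  define u where "u j = tau j - yl j / 2" for j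
  \<comment> \<open>Row 0 of the matrix \<open>X\<close> below.\<close>
  define z where "z j = 2 * tau j - yl j + c * tau j - 4 * of_bool (j = 0)" for j
  define iw where "iw k = inverse (w k)" for k
  define Y where "Y = mat (Suc m) (Suc m) (\<lambda>(l, j). lap l j + u l * tau j)"
  define Z where "Z = mat (Suc m) (Suc m) (\<lambda>(l, j). lap l j + tau l * tau j)"
  define T where "T = mat (Suc m) (Suc m) (\<lambda>(l, j). of_bool (l = j) * inverse (tau j))"
  define X where "X = mat (Suc m) (Suc m)
    (\<lambda>(l, j). 2 * tau j - yl j + c * tau j - 4 * of_bool (l = j))"
  define E where "E = (bord (\<lambda>_. 1) (\<lambda>j. of_bool (j = 0)) :: real mat)"
  note defs = Y_def Z_def T_def X_def E_def sq_mat_def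
  have carrier [simp]: "Y \<in> carrier_mat (Suc m) (Suc m)" "Z \<in> carrier_mat (Suc m) (Suc m)"
    "T \<in> carrier_mat (Suc m) (Suc m)" "X \<in> carrier_mat (Suc m) (Suc m)"
    "E \<in> carrier_mat (Suc m) (Suc m)" "sq_mat \<in> carrier_mat (Suc m) (Suc m)"
    by (simp_all add: defs)
  have mult_carrier [simp]: "A * B \<in> carrier_mat (Suc m) (Suc m)"
    if "A \<in> carrier_mat (Suc m) (Suc m)" "B \<in> carrier_mat (Suc m) (Suc m)" for A B :: "real mat"
    using that by (rule mult_carrier_mat)
  have y_tau: "y j * tau j = wdeg j" if "j \<le> m" for j
    using tau_nonzero[OF that] by (simp add: y_def)
  have sum_wdeg_eq: "(\<Sum>j\<le>m. wdeg j) = 2 * W"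
    using sum_wdeg[of "\<lambda>_. 1"] by (simp add: W_def sum_distrib_left)
  have sum_yl: "(\<Sum>j\<le>m. yl j) = 0"
    unfolding yl_def
    by (subst sum.swap, subst lap_sym) (simp add: sum_lap_const flip: sum_distrib_left)
  have sum_u: "(\<Sum>j\<le>m. u j) = 2"
    by (simp add: u_def sum_subtractf sum_tau sum_yl flip: sum_divide_distrib)
  have sum_z: "(\<Sum>j\<le>m. z j) = 2 * c"
    using sum_of_bool_eq[of 0 "\<lambda>_. 4 :: real"]
    by (simp add: z_def sum_subtractf sum.distrib sum_tau sum_yl flip: sum_distrib_left)

  \<comment> \<open>\<open>\<Delta> L y\<close> is twice \<open>D \<delta>\<close> minus the
    constant \<open>c\<close>, and \<open>\<Delta> \<tau> = D \<delta>\<close>; in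
    \<open>\<Delta> u\<close> the two copies of \<open>D \<delta>\<close> cancel.\<close>
  have sq_u: "(\<Sum>l\<le>m. (d i l)\<^sup>2 * u l) = c / 2" if "i \<le> m" for i
  proof -
    have "(\<Sum>l\<le>m. (d i l)\<^sup>2 * yl l) = (\<Sum>t\<le>m. y t * (\<Sum>l\<le>m. (d i l)\<^sup>2 * lap l t))"
      unfolding yl_def sum_distrib_left
      by (subst sum.swap) (simp add: lap_sym mult_ac)
    also have "\<dots> = (\<Sum>t\<le>m. 2 * (d i t * wdeg t) - (wdeg t)\<^sup>2 / tau t)"
      using that tau_nonzero
      by (intro sum.cong refl, subst sq_dist_lap)
        (auto simp: y_def field_simps power2_eq_square)
    also have "\<dots> = 2 * (\<Sum>t\<le>m. d i t * wdeg t) - c"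
      by (simp add: sum_subtractf c_def sum_distrib_left)
    finally have "(\<Sum>l\<le>m. (d i l)\<^sup>2 * yl l) = 2 * (\<Sum>l\<le>m. (d i l)\<^sup>2 * tau l) - c"
      using sum_sq_dist_tau[OF that] by simp
    moreover have "(\<Sum>l\<le>m. (d i l)\<^sup>2 * u l)
        = (\<Sum>l\<le>m. (d i l)\<^sup>2 * tau l) - (\<Sum>l\<le>m. (d i l)\<^sup>2 * yl l) / 2"
      by (simp add: u_def right_diff_distrib sum_subtractf sum_divide_distrib)
    ultimately show ?thesis by (simp add: diff_divide_distrib)
  qed
  \<comment> \<open>Writing \<open>wdeg j\<close> as \<open>y j * tau j\<close> exposes a factor
    \<open>tau j\<close> in every column, which \<open>T\<close> then cancels.\<close>
  have sq_Y: "(sq_mat * Y) $$ (i, j) = (2 * d i j - y j + c / 2) * tau j"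
    if "i \<le> m" "j \<le> m" for i j
  proof -
    have "(sq_mat * Y) $$ (i, j)
        = (\<Sum>l\<le>m. (d i l)\<^sup>2 * lap l j + (d i l)\<^sup>2 * u l * tau j)"
      using that by (subst index_mat_mult) (auto simp: defs algebra_simps)
    also have "\<dots> = 2 * d i j * tau j - wdeg j + c / 2 * tau j"
      using that by (simp add: sum.distrib sq_dist_lap sq_u flip: sum_distrib_right)
    finally show ?thesis using y_tau[OF that(2)] by (simp add: algebra_simps)
  qed
  have sq_YT: "(sq_mat * Y * T) $$ (i, j) = 2 * d i j - y j + c / 2"
    if "i \<le> m" "j \<le> m" for i j
  proof -
    have "(sq_mat * Y * T) $$ (i, j)
        = (\<Sum>l\<le>m. (sq_mat * Y) $$ (i, l) * inverse (tau j) * of_bool (l = j))"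
      unfolding index_mat_mult[OF mult_carrier[OF carrier(6,1)] carrier(3) that]
      using that by (intro sum.cong) (simp_all add: T_def)
    also have "\<dots> = (sq_mat * Y) $$ (i, j) * inverse (tau j)"
      using sum_of_bool_eq[OF that(2), of "\<lambda>l. (sq_mat * Y) $$ (i, l) * inverse (tau j)"] .
    finally show ?thesis using that tau_nonzero by (simp add: sq_Y)
  qed
  have c_lap: "(\<Sum>l\<le>m. c * lap l j / 2) = 0" for j
    by (simp add: sum_lap_const flip: sum_distrib_left sum_divide_distrib)
  have c_tau: "(\<Sum>l\<le>m. c * tau l / 2) = c"
    by (simp add: sum_tau flip: sum_distrib_left sum_divide_distrib)
  \<comment> \<open>In the coefficient of \<open>tau j\<close>, \<open>2 D \<tau>\<close> and the
    total weighted degree both equal \<open>2 * W\<close> and cancel, leaving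
    \<open>c\<close>.\<close>
  have prod_X: "sq_mat * Y * T * Z = X"
  proof (rule eq_matI)
    fix i j assume "i < dim_row X" "j < dim_col X"
    then have ij: "i \<le> m" "j \<le> m" by (auto simp: X_def)
    have "(sq_mat * Y * T * Z) $$ (i, j)
        = (\<Sum>l\<le>m. (2 * d i l - y l + c / 2) * (lap l j + tau l * tau j))"
      using ij by (subst index_mat_mult) (auto simp: sq_YT Z_def)
    also have "\<dots> = (\<Sum>l\<le>m. 2 * (d i l * lap l j) - y l * lap l j + c / 2 * lap l j
        + (2 * (d i l * tau l) - wdeg l + c / 2 * tau l) * tau j)"
      by (intro sum.cong refl, subst y_tau[symmetric]) (auto simp: algebra_simps)
    also have "\<dots> = 2 * (tau j - 2 * of_bool (i = j)) - yl j + c * tau j"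
      using ij c_lap[of j] c_tau by (simp add: sum.distrib sum_subtractf dist_lap sum_dist_tau sum_lap_const
        sum_tau sum_wdeg_eq yl_def W_def flip: sum_distrib_left sum_distrib_right)
    finally show "(sq_mat * Y * T * Z) $$ (i, j) = X $$ (i, j)"
      using ij by (simp add: X_def)
  qed (auto simp: defs)

  \<comment> \<open>The last columns contribute the rank-one term, so \<open>Y\<close> and
    \<open>Z\<close> become products of square matrices with known determinants up to sign.\<close>
  have bord_mult: "bord (\<lambda>_. 1) v * transpose_mat (bord iw tau)
      = mat (Suc m) (Suc m) (\<lambda>(l, j). lap l j + v l * tau j)" (is "?A = ?B") for v :: "nat \<Rightarrow> real"
  proof (rule eq_matI)
    fix i j assume "i < dim_row ?B" "j < dim_col ?B"
    then have "i \<le> m" "j \<le> m" by auto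
    then show "?A $$ (i, j) = ?B $$ (i, j)"
      by (subst index_mat_mult)
        (auto simp: bord_def lap_def iw_def divide_inverse mult_ac simp flip: lessThan_Suc_atMost)
  qed (auto simp: bord_def)
  \<comment> \<open>Differences of rows of \<open>X\<close> along edges remove its equal-row part
    and leave -4 times incidence rows; the last row of \<open>transpose_mat E\<close> selects row
    0.\<close>
  have prod_E: "transpose_mat E * X = transpose_mat (bord (\<lambda>_. - 4) z)" (is "?A = ?B")
  proof (rule eq_matI)
    fix k j assume "k < dim_row ?B" "j < dim_col ?B"
    then have kj: "k \<le> m" "j \<le> m" by (auto simp: bord_def)
    let ?col = "\<lambda>l. 2 * tau j - yl j + c * tau j - 4 * of_bool (l = j)"
    have "?A $$ (k, j)
        = (\<Sum>l\<le>m. ?col l * (if k < m then inc l k else of_bool (l = 0)))"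
      using kj by (subst index_mat_mult) (auto simp: E_def X_def bord_def intro!: sum.cong)
    also have "\<dots> = ?B $$ (k, j)"
    proof (cases "k < m")
      case True
      then show ?thesis
        using kj sum_inc[OF True, of ?col] by (auto simp: bord_def inc_def)
    next
      case False
      then show ?thesis
        using kj sum_of_bool_eq[of 0 ?col]
        by (auto simp: bord_def z_def simp del: sum_mult_of_bool_eq)
    qed
    finally show "?A $$ (k, j) = ?B $$ (k, j)" .
  qed (auto simp: bord_def E_def X_def)

  define D where "D = det (side_mat :: real mat)"
  define K where "K = det (bord iw tau)"
  define p where "p = (\<Prod>k<m. w k)"
  define t where "t = (\<Prod>j\<le>m. tau j)"
  have nz: "p \<noteq> 0" "t \<noteq> 0"
    using w_nonzero tau_nonzero by (auto simp: p_def t_def)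
  have D2: "D * D = 1"
    using det_side_mat_sq by (simp add: D_def power2_eq_square)
  have dK: "D * K = 2 / p"
    by (simp add: D_def K_def p_def det_side_bord sum_tau iw_def divide_inverse prod_inversef[of w "{..<m}", unfolded o_def])
  have dU: "D * det (bord (\<lambda>_. 1) u) = 2" and dL: "D * det (bord (\<lambda>_. 1) tau) = 2"
    by (simp_all add: D_def det_side_bord sum_tau sum_u)
  have dE: "D * det E = 1"
    using sum_of_bool_eq[of 0 "\<lambda>_. 1 :: real"] by (simp add: D_def E_def det_side_bord)
  have dz: "D * det (bord (\<lambda>_. - 4) z) = (- 4) ^ m * (2 * c)"
    by (simp add: D_def det_side_bord sum_z)
  have dY: "det Y = det (bord (\<lambda>_. 1) u) * K" and dZ: "det Z = det (bord (\<lambda>_. 1) tau) * K"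
    unfolding Y_def Z_def K_def
    by (simp_all add: det_mult[of _ "Suc m"] det_transpose[of _ "Suc m"] flip: bord_mult)
  have dT: "det T = 1 / t"
  proof -
    have "det T = prod_list (diag_mat T)"
      by (rule det_upper_triangular[of _ "Suc m"]) (auto simp: T_def upper_triangular_def)
    also have "\<dots> = (\<Prod>j\<le>m. inverse (tau j))"
      by (simp add: prod_list_diag_prod T_def atLeast0LessThan lessThan_Suc_atMost)
    finally show ?thesis by (simp add: t_def divide_inverse prod_inversef[of tau "{..m}", unfolded o_def])
  qed
  have "det E * (det sq_mat * det Y * det T * det Z) = det (transpose_mat E * (sq_mat * Y * T * Z))"
    by (simp add: det_mult[of _ "Suc m"] det_transpose[of _ "Suc m"])
  also have "\<dots> = det (bord (\<lambda>_. - 4) z)"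
    unfolding prod_X prod_E by (simp add: det_transpose[of _ "Suc m"])
  finally have "D * (det E * (det sq_mat * (det (bord (\<lambda>_. 1) u) * K) * (1 / t)
      * (det (bord (\<lambda>_. 1) tau) * K))) = (- 4) ^ m * (2 * c)"
    by (simp add: dY dZ dT dz)
  \<comment> \<open>Five bordered determinants occur on the left, each known only after
    multiplication by the sign \<open>D\<close>. One \<open>D\<close> is present, and two factors
    \<open>D * D = 1\<close> supply the other four.\<close>
  then have "(D * D) * (D * D) * (D * (det E * (det sq_mat * (det (bord (\<lambda>_. 1) u) * K) * (1 / t)
      * (det (bord (\<lambda>_. 1) tau) * K)))) = (- 4) ^ m * (2 * c)"
    by (simp add: D2)
  then have "(D * det E) * (D * det (bord (\<lambda>_. 1) u)) * (D * K) * (D * K)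
      * (D * det (bord (\<lambda>_. 1) tau)) * det sq_mat / t = (- 4) ^ m * (2 * c)"
    by (simp add: mult_ac)
  \<comment> \<open>The 16 is the product of the values 1, 2, 2, 2, 2 of the five signed
    determinants, apart from the two divisions by \<open>p\<close>.\<close>
  then have "det sq_mat * 16 / (p * p * t) = (- 4) ^ m * (2 * c)"
    unfolding dE dU dK dL by (simp add: mult_ac)
  then have "det sq_mat = (- 4) ^ m / 8 * t * (p * p) * c"
    using nz by (simp add: field_simps)
  then show ?thesis
    by (simp add: t_def p_def c_def power2_eq_square prod.distrib)
qed

end


section \<open>Squared distance matrices of trees\<close>

theorem theorem3p1:
  fixes n :: nat and e :: "nat \<Rightarrow> nat set" and w :: "nat \<Rightarrow> real"
  assumes "is_tree {1..n} (edge_set n e)"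
    and "inj_on e {1..n - 1}"
    and "\<forall>k\<in>{1..n - 1}. w k \<noteq> 0"
    and "\<forall>i\<in>{1..n}. vertex_deg n e i \<noteq> 2"
  shows "det (sq_dist_mat n e w) =
    (-1) ^ (n - 1) * (4 powi (int n - 2) / 2) * (\<Prod>i=1..n. tau n e i) * (\<Prod>k=1..n - 1. (w k)\<^sup>2)
      * (\<Sum>i=1..n. (weighted_deg n e w i)\<^sup>2 / tau n e i)"
proof -
  \<comment> \<open>A tree is nonempty, so \<open>n\<close> is a successor; from here vertices and
    edges are renumbered from 0.\<close>
  obtain m where n: "n = Suc m"
    using assms(1) by (cases n) (auto simp: is_tree_def)
  note tree = assms(1,2)
  have vertex: "Suc i \<in> {1..n}" if "i \<le> m" for i using that n by auto
  have edge: "Suc k \<in> {1..n - 1}" if "k < m" for k using that n by auto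
  have "\<exists>p. fst p \<le> m \<and> snd p \<le> m \<and> edge_away n e (Suc i) (Suc k) (Suc (fst p)) (Suc (snd p))"
    if ik: "i \<le> m" "k < m" for i k
  proof -
    obtain u v where "u \<in> {1..n}" "v \<in> {1..n}" "edge_away n e (Suc i) (Suc k) u v"
      using edge_away_exists[OF tree vertex[OF ik(1)] edge[OF ik(2)]] by blast
    then show ?thesis by (intro exI[of _ "(u - 1, v - 1)"]) (auto simp: n)
  qed
  then obtain p where p: "fst (p i k) \<le> m \<and> snd (p i k) \<le> m
      \<and> edge_away n e (Suc i) (Suc k) (Suc (fst (p i k))) (Suc (snd (p i k)))"
    if "i \<le> m" "k < m" for i k :: nat
    by metis
  define far near where "far i k = fst (p i k)" and "near i k = snd (p i k)" for i k
  have far_le: "far i k \<le> m" and near_le: "near i k \<le> m"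
    and away: "edge_away n e (Suc i) (Suc k) (Suc (far i k)) (Suc (near i k))"
    if "i \<le> m" "k < m" for i k
    using p[OF that] by (auto simp: far_def near_def)
  have ends: "e (Suc k) = {Suc (far i k), Suc (near i k)}" if "i \<le> m" "k < m" for i k
    using away[OF that] by (simp add: edge_away_def)
  have path_far: "tree_path n e (Suc i) (Suc (far i k))
      = tree_path n e (Suc i) (Suc (near i k)) @ [Suc (far i k)]" if "i \<le> m" "k < m" for i k
    using away[OF that] by (simp add: edge_away_def)
  define d where "d i j = tree_dist n e w (Suc i) (Suc j)" for i j
  \<comment> \<open>The root is vertex 1, index 0 after the shift: an edge separates
    \<open>j\<close> from it exactly when it lies on the path joining them.\<close>
  define r :: "nat \<Rightarrow> nat \<Rightarrow> int"
    where "r f j = of_bool (e (Suc f) \<in> path_edges (tree_path n e 1 (Suc j)))" for f j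
  interpret weighted_tree m "\<lambda>k. w (Suc k)" d far near r
  proof
    fix i k assume ik: "i \<le> m" "k < m"
    show "near i k \<le> m" by (rule near_le[OF ik])
    show "far i k \<noteq> near i k"
      using away[OF ik] last_tree_path[OF tree vertex[OF ik(1)] vertex[OF near_le[OF ik]]]
      by (metis edge_away_def last_in_set)
    show "{far i k, near i k} = {far 0 k, near 0 k}"
      using trans[OF ends[OF ik, symmetric] ends[OF le0 ik(2)]] by (auto simp: doubleton_eq_iff)
    show "d i (far i k) = d i (near i k) + w (Suc k)"
      unfolding d_def using away[OF ik] near_le[OF ik] ik
      by (intro tree_dist_edge_away[OF tree]) (auto simp: n)
  next
    fix i assume i: "i \<le> m"
    have range: "far i ` {..<m} \<subseteq> {..m} - {i}"
    proof
      fix j assume "j \<in> far i ` {..<m}"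
      then obtain k where k: "k < m" "j = far i k" by auto
      have "j \<noteq> i"
      proof
        assume "j = i"
        then have "[Suc i] = tree_path n e (Suc i) (Suc (near i k)) @ [Suc i]"
          using path_far[OF i k(1)] k(2) tree_path_self[OF tree vertex[OF i]] by metis
        then show False
          using last_tree_path(1)[OF tree vertex[OF i] vertex[OF near_le[OF i k(1)]]] by simp
      qed
      then show "j \<in> {..m} - {i}" using k far_le[OF i] by auto
    qed
    have "{..m} - {i} \<subseteq> far i ` {..<m}"
    proof
      fix j assume "j \<in> {..m} - {i}"
      then have "Suc j \<in> {1..n}" "Suc i \<noteq> Suc j" using vertex by auto
      then obtain k where k: "k \<in> {1..n - 1}"
        and far_j: "\<And>u v. u \<in> {1..n} \<Longrightarrow> v \<in> {1..n} \<Longrightarrow> edge_away n e (Suc i) k u v \<Longrightarrow> u = Suc j"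
        using edge_away_surj[OF tree vertex[OF i]] by blast
      obtain k' where k': "k = Suc k'" "k' < m" using k by (cases k) (auto simp: n)
      have "far i k' = j"
        using far_j[OF vertex vertex] far_le[OF i] near_le[OF i] away[OF i] k' by blast
      then show "j \<in> far i ` {..<m}" using k' by auto
    qed
    then have "far i ` {..<m} = {..m} - {i}" using range by blast
    \<comment> \<open>The map is onto a set of the same cardinality \<open>m\<close> as its domain,
      hence injective.\<close>
    moreover have "inj_on (far i) {..<m}"
      by (rule eq_card_imp_inj_on) (use calculation i in auto)
    ultimately show "bij_betw (far i) {..<m} ({..m} - {i})" by (simp add: bij_betw_def)
  next
    fix f k assume fk: "f < m" "k < m"
    show "r f (far 0 k) = r f (near 0 k) + of_bool (f = k)"
      using edge_away_path_edges[OF tree vertex[OF le0] edge[OF fk(2)]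
          vertex[OF near_le[OF le0 fk(2)]] away[OF le0 fk(2)] edge[OF fk(1)]]
      by (auto simp: r_def)
  next
    show "w (Suc k) \<noteq> 0" if "k < m" for k using assms(3) edge[OF that] by blast
    show "d i i = 0" for i by (simp add: d_def tree_dist_def)
    show "r f 0 = 0" for f using tree_path_self[OF tree vertex[OF le0]] by (simp add: r_def)
  qed
  have mem: "j \<in> {far 0 k, near 0 k} \<longleftrightarrow> Suc j \<in> e (Suc k)" if "k < m" for j k
    using ends[OF le0 that] by auto
  have shift: "(\<Sum>k | k \<in> {1..n - 1} \<and> Q k. g k) = (\<Sum>k<m. of_bool (Q (Suc k)) * g (Suc k))"
    for Q :: "nat \<Rightarrow> bool" and g :: "nat \<Rightarrow> real"
  proof -
    have "(\<Sum>k | k \<in> {1..n - 1} \<and> Q k. g k) = (\<Sum>k=1..n - 1. of_bool (Q k) * g k)"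
      by (rule sum.mono_neutral_cong_left) auto
    then show ?thesis by (simp add: n sum.atLeast1_atMost_eq)
  qed
  have tau_eq: "local.tau j = Defs.tau n e (Suc j)" for j
  proof -
    have "local.tau j = 2 - (\<Sum>k<m. of_bool (Suc j \<in> e (Suc k)) * 1)"
      unfolding local.tau_def by (auto simp del: insert_iff simp: mem intro!: sum.cong)
    then show ?thesis
      using shift[of "\<lambda>_. 1" "\<lambda>k. Suc j \<in> e k"]
      by (simp add: Defs.tau_def vertex_deg_eq_card[OF tree])
  qed
  have wdeg_eq: "wdeg j = weighted_deg n e w (Suc j)" for j
    using shift[of w "\<lambda>k. Suc j \<in> e k"]
    by (simp add: wdeg_def weighted_deg_def mem del: insert_iff)
  have mat_eq: "sq_dist_mat n e w = sq_mat"
    by (simp add: sq_dist_mat_def sq_mat_def d_def n)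
  have det_eq: "det sq_mat = (- 4) ^ m / 8 * (\<Prod>j\<le>m. local.tau j)
      * (\<Prod>k<m. (w (Suc k))\<^sup>2) * (\<Sum>j\<le>m. (wdeg j)\<^sup>2 / local.tau j)"
    \<comment> \<open>Having no vertex of degree 2 means that every \<open>tau\<close> is
      nonzero.\<close>
    by (rule det_sq_mat) (use assms(4) vertex in \<open>auto simp: tau_eq Defs.tau_def\<close>)
  \<comment> \<open>The exponent is an integer, so the case \<open>n = 1\<close>, where it is -1, is
    covered as well.\<close>
  have "(4::real) powi (int n - 2) = 4 ^ m / 4"
    using power_int_diff[of "4::real" "int m" 1] by (simp add: n)
  moreover have "(- 4 :: real) ^ m = (-1) ^ m * 4 ^ m"
    by (simp flip: power_mult_distrib)
  ultimately have factor_eq: "(-1) ^ (n - 1) * ((4::real) powi (int n - 2) / 2) = (- 4) ^ m / 8"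
    by (simp add: n)
  have index_eq: "(\<Prod>i=1..n. Defs.tau n e i) = (\<Prod>j\<le>m. local.tau j)"
    "(\<Prod>k=1..n - 1. (w k)\<^sup>2) = (\<Prod>k<m. (w (Suc k))\<^sup>2)"
    "(\<Sum>i=1..n. (weighted_deg n e w i)\<^sup>2 / Defs.tau n e i) = (\<Sum>j\<le>m. (wdeg j)\<^sup>2 / local.tau j)"
    by (simp_all add: tau_eq wdeg_eq n sum.atLeast1_atMost_eq prod.atLeast1_atMost_eq
        flip: lessThan_Suc_atMost)
  show ?thesis
    unfolding mat_eq factor_eq index_eq by (rule det_eq)
qed

end
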